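(* Let $d\ge 2$, $n\ge 2$, $T>0$, and $0\le k\le n-2$. For every word $w\in\mathcal{W}_{2n}^{k}$, $$C^{w}(\phi^{M}(T)) = \frac{1}{12 \cdot (n-1)!} \left( \frac{T}{2} \right)^{n-1} \frac{T}{M} + O\!\left( \frac{1}{M^{2}} \right)\qquad\text{as } M\to\infty.$$
   Context: Let $(e_1,\dots,e_d)$ be the standard basis of $\mathbb{R}^d$ and $B_t=\sum_{j=1}^d B_t^j e_j$, where $B^1,\dots,B^d$ are independent standard one-dimensional Brownian motions started at $0$. A word of length $n$ is $w=e_{i_1}\cdots e_{i_n}$ with $1\le i_1,\dots,i_n\le d$; $*$ denotes concatenation of words. $B^{(M)}$ ($M\ge1$ an integer) is the piecewise linear path on $[0,T]$ that coincides with $B$ at the points $kT/M$, $k=0,\dots,M$, and is linear on each $[kT/M,(k+1)T/M]$. For $w=e_{i_1}\cdots e_{i_n}$, $C^w(\phi^M(T))$ denotes the coefficient of $w$ in the expected signature $\phi^M(T)$ of $B^{(M)}$ over $[0,T]$, i.e. the expectation of the iterated integral $\int_{0<u_1<\cdots<u_n<T} d(B^{(M)})^{i_1}_{u_1}\cdots d(B^{(M)})^{i_n}_{u_n}$ (equal to $1$ for the empty word). Sets of words: $\mathcal{S}_{2m}=\{e_{i_1}^2\cdots e_{i_m}^2 : 1\le i_1,\dots,i_m\le d\}$ for $m\ge0$ (so $\mathcal{S}_0$ consists of the empty word); $\mathcal{E}=\{e_ie_je_ie_j,\ e_ie_je_je_i : 1\le i,j\le d,\ i\ne j\}$; for $0\le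 k\le n-2$, $\mathcal{W}_{2n}^k=\{v*v'*v'' : v\in\mathcal{S}_{2k},\ v'\in\mathcal{E},\ v''\in\mathcal{S}_{2n-4-2k}\}$. The $O(\cdot)$ is for $d,n,T$ fixed. *)

theory Defs
  imports "HOL-Probability.Probability"
begin

text \<open>
  Points of \<open>R^d\<close> are vectors of type \<open>real ^ 'd\<close> with \<open>d = CARD('d)\<close>. The word
  \<open>e_{i_1} ... e_{i_n}\<close> is the list \<open>[i_1, ..., i_n]\<close> of its indices.
\<close>

subsection \<open>Brownian motion\<close>

definition std_brownian_motion :: "'a measure \<Rightarrow> (real \<Rightarrow> 'a \<Rightarrow> real) \<Rightarrow> bool" where
  "std_brownian_motion P X \<longleftrightarrow>
     (\<forall>t\<ge>0. X t \<in> borel_measurable P) \<and>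
     (AE \<omega> in P. X 0 \<omega> = 0) \<and>
     (\<forall>s t. 0 \<le> s \<longrightarrow> s < t \<longrightarrow>
        distributed P lborel (\<lambda>\<omega>. X t \<omega> - X s \<omega>) (normal_density 0 (sqrt (t - s)))) \<and>
     (\<forall>(n::nat) \<tau>. 0 \<le> \<tau> 0 \<longrightarrow> (\<forall>i<n. \<tau> i < \<tau> (Suc i)) \<longrightarrow>
        prob_space.indep_vars P (\<lambda>_. borel) (\<lambda>i \<omega>. X (\<tau> (Suc i)) \<omega> - X (\<tau> i) \<omega>) {..<n}) \<and>
     (AE \<omega> in P. continuous_on {0..} (\<lambda>t. X t \<omega>))"

text \<open>The components are independent as processes, i.e.\ as random elements of \<open>R^[0,\<infinity>)\<close>.\<close>

definition brownian_motion :: "'a measure \<Rightarrow> (real \<Rightarrow> 'a \<Rightarrow> real ^ 'd) \<Rightarrow> bool" where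
  "brownian_motion P B \<longleftrightarrow>
     (\<forall>j. std_brownian_motion P (\<lambda>t \<omega>. B t \<omega> $ j)) \<and>
     prob_space.indep_vars P (\<lambda>_. PiM {0..} (\<lambda>_. borel))
       (\<lambda>j \<omega>. \<lambda>t\<in>{0..}. B t \<omega> $ j) UNIV"

subsection \<open>Piecewise linear interpolation\<close>

definition piecewise_linear :: "real \<Rightarrow> nat \<Rightarrow> (real \<Rightarrow> 'b::real_normed_vector) \<Rightarrow> real \<Rightarrow> 'b" where
  "piecewise_linear T M b t =
     (let h = T / real M; k = real_of_int \<lfloor>t / h\<rfloor>
      in linepath (b (k * h)) (b ((k + 1) * h)) (t / h - k))"

lemma piecewise_linear_segment:
  assumes "T > 0" and "M \<ge> 1"
    and t: "t \<in> {real k * (T / real M) .. (real k + 1) * (T / real M)}"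
  shows "piecewise_linear T M b t =
    linepath (b (real k * (T / real M))) (b ((real k + 1) * (T / real M)))
      (t / (T / real M) - real k)"
proof -
  define h where "h = T / real M"
  have "h > 0"
    using assms by (simp add: h_def)
  show ?thesis
  proof (cases "t = (real k + 1) * h")
    case True
    then have "t / h = real (k + 1)"
      using \<open>h > 0\<close> by simp
    moreover from this have "\<lfloor>t / h\<rfloor> = int (k + 1)"
      by (metis floor_of_nat)
    ultimately show ?thesis
      unfolding piecewise_linear_def Let_def h_def [symmetric] by (simp add: linepath_def add.commute)
  next
    case False
    then have "real k * h \<le> t" "t < (real k + 1) * h"
      using t unfolding h_def [symmetric] by auto
    then have "real k \<le> t / h" "t / h < real k + 1"
      using \<open>h > 0\<close> by (simp_all only: pos_le_divide_eq pos_divide_less_eq)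
    then have "\<lfloor>t / h\<rfloor> = int k"
      by (intro floor_unique) simp_all
    then show ?thesis
      unfolding piecewise_linear_def Let_def h_def [symmetric] by simp
  qed
qed

subsection \<open>Expected signature\<close>

text \<open>
  \<open>iterated_integral x w s t\<close> is the integral of \<open>dx^{i_1}_{u_1} ... dx^{i_n}_{u_n}\<close> over
  \<open>s < u_1 < ... < u_n < t\<close> for \<open>w = [i_1, ..., i_n]\<close>; the outermost variable of integration
  is \<open>u_1\<close>. It is meant for piecewise continuously differentiable paths, for which \<open>dx_u\<close> is
  \<open>x'(u) du\<close>; at the finitely many break points \<open>deriv\<close> takes an arbitrary value, which does
  not affect the integral.
\<close>

primrec iterated_integral :: "(real \<Rightarrow> real ^ 'd) \<Rightarrow> 'd list \<Rightarrow> real \<Rightarrow> real \<Rightarrow> real" where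
  "iterated_integral x [] s t = 1"
| "iterated_integral x (i # w) s t =
     integral {s..t} (\<lambda>u. iterated_integral x w u t * deriv (\<lambda>r. x r $ i) u)"

definition expected_sig_coeff ::
    "'a measure \<Rightarrow> (real \<Rightarrow> 'a \<Rightarrow> real ^ 'd) \<Rightarrow> real \<Rightarrow> 'd list \<Rightarrow> real" where
  "expected_sig_coeff P X T w = (LINT \<omega>|P. iterated_integral (\<lambda>t. X t \<omega>) w 0 T)"

subsection \<open>Sets of words\<close>

text \<open>\<open>square_words m\<close> is the set \<open>S_{2m}\<close>: words of length \<open>2m\<close>.\<close>

definition square_words :: "nat \<Rightarrow> 'd list set" where
  "square_words m = {concat (map (\<lambda>i. [i, i]) is) | is. length is = m}"

definition E_words :: "'d list set" where
  "E_words = {[i, j, i, j] | i j. i \<noteq> j} \<union> {[i, j, j, i] | i j. i \<noteq> j}"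

text \<open>\<open>W_words n k\<close> is the set \<open>W_{2n}^k\<close>, for \<open>k \<le> n - 2\<close>; note \<open>2n - 4 - 2k = 2(n - 2 - k)\<close>.\<close>

definition W_words :: "nat \<Rightarrow> nat \<Rightarrow> 'd list set" where
  "W_words n k = {v @ v' @ v'' | v v' v''.
     v \<in> square_words k \<and> v' \<in> E_words \<and> v'' \<in> square_words (n - 2 - k)}"

end

theory Submission
  imports Defs
begin

text \<open>
  Put \<open>h = T / M\<close>. On each step of the partition the interpolated path is a straight segment with
  increment \<open>v\<close>, and the signature of a segment is the tensor exponential of \<open>v\<close>: the coefficient
  of a word \<open>u\<close> is the product of the coordinates of \<open>v\<close> along \<open>u\<close>, divided by \<open>|u|!\<close>. By Chen's
  identity the signature of the whole path is the product of these exponentials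
  (\<open>iterated_integral_piecewise_linear\<close>). The increments are independent and normal with variance
  \<open>h\<close>, so the expectation of the product is the \<open>M\<close>-th power of the expected signature of a single
  segment, and Brownian scaling extracts the factor \<open>h\<close> to the power \<open>|w| / 2\<close>
  (\<open>expected_sig_coeff_piecewise_linear\<close>).

  The coefficient of \<open>w\<close> in an \<open>M\<close>-th power is a sum over the ways to cut \<open>w\<close> into \<open>M\<close> consecutive,
  possibly empty, blocks. Choosing which factors receive the nonempty blocks gives
  \<open>\<Sum>q. (M choose q) * block_sum q w\<close>, where \<open>block_sum q w\<close> runs over the cuts into \<open>q\<close> nonempty
  blocks (\<open>gauss_chain_conv_block_sum\<close>). Odd blocks have moment zero, so for \<open>|w| = 2 n\<close> only
  \<open>q \<le> n\<close> contributes, and the prefactor \<open>(T / M) ^ n\<close> turns the term of index \<open>q\<close> into one of order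
  \<open>M ^ (q - n)\<close>.

  For the words in question the term \<open>q = n\<close> vanishes: all blocks would be pairs, and the two pairs of
  the middle factor \<open>e_i e_j e_i e_j\<close> or \<open>e_i e_j e_j e_i\<close> are pairs of different letters. In the term
  \<open>q = n - 1\<close> there is one block of length four and the rest are pairs, so the long block must be
  exactly the middle factor (\<open>block_sum_one_crossing\<close>). It contributes \<open>1 / 4!\<close>, each of the \<open>n - 2\<close>
  square pairs \<open>1 / 2\<close>, and \<open>(M choose (n - 1))\<close> is \<open>M ^ (n - 1) / (n - 1)!\<close> up to \<open>O(M ^ (n - 2))\<close>;
  together this is the claimed leading term.
\<close>

section \<open>The signature of a piecewise linear path\<close>

definition word_power :: "real ^ 'd \<Rightarrow> 'd list \<Rightarrow> real" where
  "word_power v u = (\<Prod>i\<leftarrow>u. v $ i)"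

lemma word_power_simps [simp]:
  "word_power v [] = 1"
  "word_power v (i # u) = v $ i * word_power v u"
  by (simp_all add: word_power_def)

text \<open>
  Coefficients of the product of the tensor exponentials of the listed increments: the first
  increment takes a prefix of the word, and the later ones share what is left.
\<close>

primrec chain_sig :: "(real ^ 'd) list \<Rightarrow> 'd list \<Rightarrow> real" where
  "chain_sig [] w = (if w = [] then 1 else 0)"
| "chain_sig (v # vs) w =
     (\<Sum>p\<le>length w. word_power v (take p w) / fact p * chain_sig vs (drop p w))"

lemma chain_sig_Nil_word [simp]: "chain_sig vs [] = 1"
  by (induction vs) simp_all

text \<open>
  The variable \<open>(a - u) / h\<close> is the fraction of the segment that is still ahead of \<open>u\<close>. The iterated
  integrals are polynomials in it because the outermost variable of integration is the earliest one.
\<close>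

lemma has_integral_segment_power:
  fixes h a s :: real
  assumes "h > 0" and "s \<le> a"
  shows "((\<lambda>u. ((a - u) / h) ^ p / fact p / h) has_integral ((a - s) / h) ^ Suc p / fact (Suc p)) {s..a}"
proof -
  let ?G = "\<lambda>u. - (((a - u) / h) ^ Suc p / fact (Suc p))"
  have "((\<lambda>u. (a - u) / h) has_real_derivative - (1 / h)) (at u within {s..a})" for u
    using \<open>h > 0\<close> by (auto intro!: derivative_eq_intros)
  from DERIV_minus [OF DERIV_cdivide [OF DERIV_power_Suc [OF this, of p], of "fact (Suc p)"]]
  have "(?G has_real_derivative ((a - u) / h) ^ p / fact p / h) (at u within {s..a})" for u
    by (simp add: divide_simps mult_ac split: if_splits)
  then have "(?G has_vector_derivative ((a - u) / h) ^ p / fact p / h) (at u within {s..a})" for u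
    by (simp only: has_real_derivative_iff_has_vector_derivative)
  then have "((\<lambda>u. ((a - u) / h) ^ p / fact p / h) has_integral (?G a - ?G s)) {s..a}"
    by (intro fundamental_theorem_of_calculus assms)
  then show ?thesis by simp
qed

text \<open>
  Chen's identity for a start \<open>s\<close> inside segment number \<open>l\<close>: a prefix of \<open>w\<close> is used up on the rest of
  that segment, the remaining letters on the later ones. Allowing every \<open>s\<close> in the segment is what makes
  the induction on the word possible: the induction hypothesis gives the integrand for the next letter as
  an explicit polynomial on each segment.
\<close>

theorem iterated_integral_segment:
  fixes x :: "real \<Rightarrow> real ^ 'd" and \<delta> :: "nat \<Rightarrow> real ^ 'd"
  assumes h: "h > 0"
    and deriv: "\<And>l u i. l < M \<Longrightarrow> real l * h < u \<Longrightarrow> u < real (Suc l) * h \<Longrightarrow>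
                  deriv (\<lambda>r. x r $ i) u = \<delta> l $ i / h"
    and "l < M" and "real l * h \<le> s" and "s \<le> real (Suc l) * h"
  shows "iterated_integral x w s (real M * h) =
    (\<Sum>p\<le>length w. word_power (\<delta> l) (take p w) * ((real (Suc l) * h - s) / h) ^ p / fact p *
       chain_sig (map \<delta> [Suc l..<M]) (drop p w))"
  using assms(3-)
proof (induction w arbitrary: l s)
  case Nil
  then show ?case by simp
next
  case (Cons i w)
  define f where "f u = iterated_integral x w u (real M * h) * deriv (\<lambda>r. x r $ i) u" for u
  \<comment> \<open>the part of the sum in which segment \<open>l\<close> takes at least the letter \<open>i\<close>\<close>
  define J where "J l s = (\<Sum>p\<le>length w. word_power (\<delta> l) (take (Suc p) (i # w)) *
      (((real (Suc l) * h - s) / h) ^ Suc p / fact (Suc p)) *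
      chain_sig (map \<delta> [Suc l..<M]) (drop p w))" for l s
  have segment: "(f has_integral J l s) {s..real (Suc l) * h}"
    if l: "l < M" and s: "real l * h \<le> s" "s \<le> real (Suc l) * h" for l s
  proof -
    let ?g = "\<lambda>u. \<Sum>p\<le>length w. word_power (\<delta> l) (take (Suc p) (i # w)) *
      (((real (Suc l) * h - u) / h) ^ p / fact p / h) * chain_sig (map \<delta> [Suc l..<M]) (drop p w)"
    have g: "(?g has_integral J l s) {s..real (Suc l) * h}"
      unfolding J_def
      by (intro has_integral_sum has_integral_mult_left has_integral_mult_right
          has_integral_segment_power h s) simp
    have f: "f u = ?g u" if "u \<in> {s..real (Suc l) * h} - {real l * h, real (Suc l) * h}" for u
    proof -
      have u: "real l * h \<le> u" "u \<le> real (Suc l) * h" "real l * h < u" "u < real (Suc l) * h"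
        using that s by auto
      have "f u = (\<Sum>p\<le>length w. word_power (\<delta> l) (take p w) * ((real (Suc l) * h - u) / h) ^ p /
          fact p * chain_sig (map \<delta> [Suc l..<M]) (drop p w)) * (\<delta> l $ i / h)"
        unfolding f_def using Cons.IH [OF l u(1,2)] deriv [OF l u(3,4)] by simp
      also have "\<dots> = ?g u"
        unfolding sum_distrib_right by (intro sum.cong refl) (simp add: mult_ac)
      finally show ?thesis .
    qed
    show ?thesis
      by (intro has_integral_spike_finite [where f = ?g and S = "{real l * h, real (Suc l) * h}", OF _ f g]) auto
  qed
  have chain_step: "chain_sig (map \<delta> [l..<M]) (i # w) = J l (real l * h) + chain_sig (map \<delta> [Suc l..<M]) (i # w)"
    if "l < M" for l
  proof -
    have "(real (Suc l) * h - real l * h) / h = 1"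
      using h by (simp add: field_simps)
    moreover have "[l..<M] = l # [Suc l..<M]"
      using that by (simp add: upt_conv_Cons)
    ultimately show ?thesis
      by (simp add: J_def sum.atMost_Suc_shift del: sum.atMost_Suc of_nat_Suc upt_Suc)
  qed
  \<comment> \<open>integrability over all later segments, by gluing them together from the last one backwards\<close>
  have grid: "(f has_integral chain_sig (map \<delta> [l..<M]) (i # w)) {real l * h..real M * h}" if "l \<le> M" for l
    using that
  proof (induction rule: inc_induct)
    case base
    then show ?case by (simp add: has_integral_refl)
  next
    case (step l)
    have "(f has_integral (J l (real l * h) + chain_sig (map \<delta> [Suc l..<M]) (i # w)))
        {real l * h..real M * h}"
    proof (rule has_integral_combine [OF _ _ segment step.IH])
      show "real (Suc l) * h \<le> real M * h"
        using step.hyps h by (intro mult_right_mono) auto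
    qed (use step.hyps h in \<open>auto simp: mult_right_mono\<close>)
    then show ?case
      using chain_step step.hyps by simp
  qed
  have "(f has_integral (J l s + chain_sig (map \<delta> [Suc l..<M]) (i # w))) {s..real M * h}"
  proof (rule has_integral_combine [OF _ _ segment grid])
    show "real (Suc l) * h \<le> real M * h"
      using Cons.prems h by (intro mult_right_mono) auto
  qed (use Cons.prems in auto)
  then have "iterated_integral x (i # w) s (real M * h) = J l s + chain_sig (map \<delta> [Suc l..<M]) (i # w)"
    unfolding f_def by (simp add: integral_unique)
  also have "\<dots> = (\<Sum>p\<le>length (i # w). word_power (\<delta> l) (take p (i # w)) *
      ((real (Suc l) * h - s) / h) ^ p / fact p * chain_sig (map \<delta> [Suc l..<M]) (drop p (i # w)))"
    by (simp add: J_def sum.atMost_Suc_shift add.commute del: sum.atMost_Suc of_nat_Suc upt_Suc)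
  finally show ?case .
qed

corollary iterated_integral_chain_sig:
  fixes x :: "real \<Rightarrow> real ^ 'd" and \<delta> :: "nat \<Rightarrow> real ^ 'd"
  assumes h: "h > 0" and "M > 0"
    and deriv: "\<And>l u i. l < M \<Longrightarrow> real l * h < u \<Longrightarrow> u < real (Suc l) * h \<Longrightarrow>
                  deriv (\<lambda>r. x r $ i) u = \<delta> l $ i / h"
  shows "iterated_integral x w 0 (real M * h) = chain_sig (map \<delta> [0..<M]) w"
proof -
  have "[0..<M] = 0 # [Suc 0..<M]"
    using \<open>M > 0\<close> by (simp add: upt_conv_Cons)
  then show ?thesis
    using iterated_integral_segment [OF h deriv, where M = M and l = 0 and s = 0 and w = w] h \<open>M > 0\<close> by simp
qed

lemma deriv_piecewise_linear:
  fixes b :: "real \<Rightarrow> real ^ 'd"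
  assumes "T > 0" and "M \<ge> 1" and h: "h = T / real M"
    and u: "real l * h < u" "u < real (Suc l) * h"
  shows "deriv (\<lambda>r. piecewise_linear T M b r $ i) u = (b (real (Suc l) * h) - b (real l * h)) $ i / h"
proof -
  have "h > 0"
    using assms by simp
  let ?a = "b (real l * h)" and ?c = "b (real (Suc l) * h)"
  let ?g = "\<lambda>r. (1 - (r / h - real l)) * ?a $ i + (r / h - real l) * ?c $ i"
  have "(?g has_real_derivative (?c - ?a) $ i / h) (at u)"
    using \<open>h > 0\<close> by (auto intro!: derivative_eq_intros simp: field_simps)
  moreover have "eventually (\<lambda>r. r \<in> {real l * h<..<real (Suc l) * h}) (nhds u)"
    using u by (intro eventually_nhds_in_open) auto
  then have "eventually (\<lambda>r. piecewise_linear T M b r $ i = ?g r) (nhds u)"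
  proof eventually_elim
    case (elim r)
    then have "piecewise_linear T M b r = linepath ?a ?c (r / h - real l)"
      using piecewise_linear_segment [OF assms(1,2), of r l b] by (simp add: h add.commute)
    then show ?case
      by (simp add: linepath_def)
  qed
  ultimately have "((\<lambda>r. piecewise_linear T M b r $ i) has_real_derivative (?c - ?a) $ i / h) (at u)"
    by (subst DERIV_cong_ev [OF refl _ refl])
  then show ?thesis
    by (rule DERIV_imp_deriv)
qed

corollary iterated_integral_piecewise_linear:
  fixes b :: "real \<Rightarrow> real ^ 'd"
  assumes "T > 0" and "M \<ge> 1" and h: "h = T / real M"
  shows "iterated_integral (piecewise_linear T M b) w 0 T =
    chain_sig (map (\<lambda>l. b (real (Suc l) * h) - b (real l * h)) [0..<M]) w"
proof -
  have "h > 0" and T: "real M * h = T"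
    using assms by simp_all
  show ?thesis
    unfolding T [symmetric]
    by (rule iterated_integral_chain_sig [OF \<open>h > 0\<close>])
      (use deriv_piecewise_linear [OF assms(1,2) h] assms(2) T in auto)
qed

section \<open>Moments of words in Gaussian vectors\<close>

definition gauss_moment :: "nat \<Rightarrow> real" where
  "gauss_moment a = (if even a then fact a / (2 ^ (a div 2) * fact (a div 2)) else 0)"

lemma gauss_moment_simps [simp]:
  "gauss_moment 0 = 1" "gauss_moment (Suc 0) = 0" "gauss_moment 2 = 1"
  by (simp_all add: gauss_moment_def)

lemma gauss_moment_odd: "odd a \<Longrightarrow> gauss_moment a = 0"
  by (simp add: gauss_moment_def)

lemma has_bochner_integral_normal_power:
  assumes "\<sigma> > 0"
  shows "has_bochner_integral lborel (\<lambda>x. normal_density 0 \<sigma> x * x ^ a) (\<sigma> ^ a * gauss_moment a)"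
proof (cases "even a")
  case True
  then obtain k where a: "a = 2 * k" by (rule evenE)
  have "\<sigma> ^ a * gauss_moment a = fact (2 * k) / ((2 / \<sigma>\<^sup>2) ^ k * fact k)"
    using assms by (simp add: a gauss_moment_def power_divide power_mult)
  then show ?thesis
    using normal_moment_even [OF assms, of 0 k] by (simp add: a)
next
  case False
  then obtain k where "a = 2 * k + 1" by (rule oddE)
  then show ?thesis
    using normal_moment_odd [OF assms, of 0 k] by (simp add: gauss_moment_odd)
qed

definition word_moment :: "'d::finite list \<Rightarrow> real" where
  "word_moment u = (\<Prod>j\<in>UNIV. gauss_moment (count_list u j))"

lemma word_power_conv_count:
  "word_power v u = (\<Prod>j\<in>UNIV. (v $ j) ^ count_list u j)"
proof (induction u)
  case Nil
  then show ?case by simp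
next
  case (Cons i u)
  have "(\<Prod>j\<in>UNIV. (v $ j) ^ count_list (i # u) j) =
      (\<Prod>j\<in>UNIV. (if j = i then v $ j else 1) * (v $ j) ^ count_list u j)"
    by (intro prod.cong) auto
  then show ?case
    using Cons by (simp add: prod.distrib)
qed

text \<open>
  An odd word contains some letter an odd number of times, and that coordinate has moment zero.
\<close>

lemma word_moment_odd:
  fixes u :: "'d::finite list"
  assumes "odd (length u)"
  shows "word_moment u = 0"
proof -
  have "odd (\<Sum>j\<in>UNIV. count_list u j)"
    using assms by (subst sum_count_set) auto
  then obtain j where "odd (count_list u j)"
    by (metis dvd_sum)
  then show ?thesis
    unfolding word_moment_def by (auto intro: gauss_moment_odd)
qed

lemma word_moment_Nil [simp]: "word_moment [] = 1"
  by (simp add: word_moment_def)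

lemma word_moment_pair: "word_moment [i, j] = (if i = j then 1 else 0)"
proof (cases "i = j")
  case True
  then show ?thesis
    by (auto simp: word_moment_def numeral_2_eq_2 [symmetric] intro!: prod.neutral)
next
  case False
  then show ?thesis
    unfolding word_moment_def by (auto intro!: bexI [of _ i])
qed

text \<open>
  Every letter occurs twice or not at all, however the pairs are interleaved.
\<close>

lemma word_moment_crossing:
  assumes "i \<noteq> j"
  shows "word_moment [i, j, i, j] = 1" and "word_moment [i, j, j, i] = 1"
  using assms by (auto simp: word_moment_def numeral_2_eq_2 [symmetric] intro!: prod.neutral)

section \<open>The expected signature\<close>

lemma (in prob_space) std_brownian_motion_increment_moments:
  fixes X :: "real \<Rightarrow> 'a \<Rightarrow> real"
  assumes X: "std_brownian_motion M X" and "h > 0"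
  shows "has_bochner_integral M
    (\<lambda>\<omega>. \<Prod>l<m. (X (real (Suc l) * h) \<omega> - X (real l * h) \<omega>) ^ a l)
    (\<Prod>l<m. sqrt h ^ a l * gauss_moment (a l))"
proof -
  define D where "D l \<omega> = X (real (Suc l) * h) \<omega> - X (real l * h) \<omega>" for l \<omega>
  have step: "real l * h < real (Suc l) * h" and nonneg: "0 \<le> real l * h" for l
    using \<open>h > 0\<close> by (auto intro!: mult_strict_right_mono)
  have "indep_vars (\<lambda>_. borel) (\<lambda>l \<omega>. X (real (Suc l) * h) \<omega> - X (real l * h) \<omega>) {..<m}"
    using X step nonneg unfolding std_brownian_motion_def
    by (elim conjE allE [where x = m] allE [where x = "\<lambda>l. real l * h"]) blast
  then have "indep_vars (\<lambda>_. borel) D {..<m}"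
    by (simp only: D_def [abs_def])
  then have indep: "indep_vars (\<lambda>_. borel) (\<lambda>l \<omega>. D l \<omega> ^ a l) {..<m}"
    by (rule indep_vars_compose2) measurable
  have mom: "has_bochner_integral M (\<lambda>\<omega>. D l \<omega> ^ a l) (sqrt h ^ a l * gauss_moment (a l))" for l
  proof -
    have "real (Suc l) * h - real l * h = h"
      by (simp add: algebra_simps)
    then have dist: "distributed M lborel (D l) (normal_density 0 (sqrt h))"
      using X step [of l] nonneg [of l] unfolding std_brownian_motion_def D_def by metis
    note normal = has_bochner_integral_normal_power [of "sqrt h" "a l"]
    have "integrable M (\<lambda>\<omega>. D l \<omega> ^ a l)"
      using normal \<open>h > 0\<close> distributed_integrable [OF dist, of "\<lambda>x. x ^ a l"]
      by (auto dest: integrable.intros)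
    moreover have "(\<integral>\<omega>. D l \<omega> ^ a l \<partial>M) = sqrt h ^ a l * gauss_moment (a l)"
      using normal \<open>h > 0\<close> distributed_integral [OF dist, of "\<lambda>x. x ^ a l"]
      by (auto dest: has_bochner_integral_integral_eq)
    ultimately show ?thesis
      by (simp add: has_bochner_integral_iff)
  qed
  show ?thesis
    using indep_vars_lebesgue_integral [OF _ indep] indep_vars_integrable [OF _ indep] mom
    unfolding D_def [symmetric] has_bochner_integral_iff by simp
qed

text \<open>
  Independence is given separately for the coordinate processes and for the increments of each of them.
  So the product is regrouped by coordinate, factored over the coordinates (each factor is a measurable
  function of one process), and then each factor splits over the time steps.
\<close>

lemma (in prob_space) brownian_motion_word_power_moments:
  fixes B :: "real \<Rightarrow> 'a \<Rightarrow> real ^ 'd"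
  assumes B: "brownian_motion M B" and "h > 0"
  shows "has_bochner_integral M
    (\<lambda>\<omega>. \<Prod>l<m. word_power (B (real (Suc l) * h) \<omega> - B (real l * h) \<omega>) (u l))
    (\<Prod>l<m. sqrt h ^ length (u l) * word_moment (u l))"
proof -
  define Y where "Y j \<omega> = (\<Prod>l<m. (B (real (Suc l) * h) \<omega> $ j - B (real l * h) \<omega> $ j) ^ count_list (u l) j)" for j \<omega>
  define g :: "'d \<Rightarrow> (real \<Rightarrow> real) \<Rightarrow> real"
    where "g j y = (\<Prod>l<m. (y (real (Suc l) * h) - y (real l * h)) ^ count_list (u l) j)" for j y
  have nonneg: "0 \<le> real l * h" for l
    using \<open>h > 0\<close> by simp
  have "(\<lambda>y. y (real l * h)) \<in> borel_measurable (PiM {0..} (\<lambda>_. borel))" for l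
    using nonneg by (intro measurable_component_singleton) simp
  then have g: "g j \<in> borel_measurable (PiM {0..} (\<lambda>_. borel))" for j
    unfolding g_def by (intro borel_measurable_prod borel_measurable_power borel_measurable_diff)
  have "indep_vars (\<lambda>_. borel) (\<lambda>j \<omega>. g j (\<lambda>t\<in>{0..}. B t \<omega> $ j)) UNIV"
    using B unfolding brownian_motion_def by (intro indep_vars_compose2 [OF _ g]) simp
  moreover have "g j (\<lambda>t\<in>{0..}. B t \<omega> $ j) = Y j \<omega>" for j \<omega>
    using nonneg by (simp add: g_def Y_def del: of_nat_Suc)
  ultimately have indep: "indep_vars (\<lambda>_. borel) Y UNIV"
    by simp
  have mom: "has_bochner_integral M (Y j) (\<Prod>l<m. sqrt h ^ count_list (u l) j * gauss_moment (count_list (u l) j))"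
    for j
    using B unfolding Y_def brownian_motion_def
    by (intro std_brownian_motion_increment_moments \<open>h > 0\<close>) simp
  have "(\<Prod>j\<in>UNIV. sqrt h ^ count_list v j * gauss_moment (count_list v j)) =
      sqrt h ^ length v * word_moment v" for v :: "'d list"
    by (simp add: prod.distrib word_moment_def power_sum [symmetric] sum_count_set)
  then have "(\<Prod>j\<in>UNIV. \<Prod>l<m. sqrt h ^ count_list (u l) j * gauss_moment (count_list (u l) j)) =
      (\<Prod>l<m. sqrt h ^ length (u l) * word_moment (u l))"
    by (subst prod.swap) simp
  then have "has_bochner_integral M (\<lambda>\<omega>. \<Prod>j\<in>UNIV. Y j \<omega>)
      (\<Prod>l<m. sqrt h ^ length (u l) * word_moment (u l))"
    using indep_vars_lebesgue_integral [OF _ indep] indep_vars_integrable [OF _ indep] mom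
    by (simp add: has_bochner_integral_iff)
  moreover have "(\<Prod>j\<in>UNIV. Y j \<omega>) =
      (\<Prod>l<m. word_power (B (real (Suc l) * h) \<omega> - B (real l * h) \<omega>) (u l))" for \<omega>
    unfolding Y_def word_power_conv_count by (subst prod.swap) simp
  ultimately show ?thesis
    by simp
qed

text \<open>
  The coefficient of a word in the \<open>m\<close>-th power of the expected tensor exponential of a standard
  normal vector.
\<close>

primrec gauss_chain :: "nat \<Rightarrow> 'd::finite list \<Rightarrow> real" where
  "gauss_chain 0 w = (if w = [] then 1 else 0)"
| "gauss_chain (Suc m) w =
     (\<Sum>p\<le>length w. word_moment (take p w) / fact p * gauss_chain m (drop p w))"

text \<open>
  The factor over \<open>l < m\<close> is the accumulator for the induction: unfolding \<open>chain_sig\<close> moves the monomial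
  of increment number \<open>m\<close> into it, so that independence is only ever used for a product of monomials,
  never for the signatures themselves.
\<close>

lemma (in prob_space) expectation_word_powers_chain_sig:
  fixes B :: "real \<Rightarrow> 'a \<Rightarrow> real ^ 'd"
  assumes B: "brownian_motion M B" and "h > 0"
  defines "\<delta> \<equiv> \<lambda>\<omega> l. B (real (Suc l) * h) \<omega> - B (real l * h) \<omega>"
  shows "has_bochner_integral M
    (\<lambda>\<omega>. (\<Prod>l<m. word_power (\<delta> \<omega> l) (u l)) * chain_sig (map (\<delta> \<omega>) [m..<m + r]) w)
    ((\<Prod>l<m. sqrt h ^ length (u l) * word_moment (u l)) * (sqrt h ^ length w * gauss_chain r w))"
proof (induction r arbitrary: m u w)
  case 0
  show ?case
    using brownian_motion_word_power_moments [OF B \<open>h > 0\<close>, where m = m and u = u]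
    by (cases w) (simp_all add: \<delta>_def has_bochner_integral_zero)
next
  case (Suc r)
  define v where "v p = u(m := take p w)" for p
  have upd: "(\<Prod>l<Suc m. F l (v p l)) = (\<Prod>l<m. F l (u l)) * F m (take p w)"
    for F :: "nat \<Rightarrow> 'd list \<Rightarrow> real" and p
  proof -
    have "(\<Prod>l<m. F l (v p l)) = (\<Prod>l<m. F l (u l))"
      by (intro prod.cong) (auto simp: v_def)
    then show ?thesis by (simp add: v_def)
  qed
  have "has_bochner_integral M
    (\<lambda>\<omega>. \<Sum>p\<le>length w. ((\<Prod>l<Suc m. word_power (\<delta> \<omega> l) (v p l)) *
        chain_sig (map (\<delta> \<omega>) [Suc m..<Suc m + r]) (drop p w)) / fact p)
    (\<Sum>p\<le>length w. ((\<Prod>l<Suc m. sqrt h ^ length (v p l) * word_moment (v p l)) *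
        (sqrt h ^ length (drop p w) * gauss_chain r (drop p w))) / fact p)"
    by (intro has_bochner_integral_sum has_bochner_integral_divide_zero Suc.IH)
  moreover have "(\<Sum>p\<le>length w. ((\<Prod>l<Suc m. word_power (\<delta> \<omega> l) (v p l)) *
        chain_sig (map (\<delta> \<omega>) [Suc m..<Suc m + r]) (drop p w)) / fact p) =
      (\<Prod>l<m. word_power (\<delta> \<omega> l) (u l)) * chain_sig (map (\<delta> \<omega>) [m..<m + Suc r]) w" for \<omega>
  proof -
    have "[m..<m + Suc r] = m # [Suc m..<Suc m + r]"
      by (simp add: upt_conv_Cons del: upt_Suc)
    then show ?thesis
      unfolding upd [of "\<lambda>l. word_power (\<delta> \<omega> l)"]
      by (simp add: sum_distrib_left mult_ac del: upt_Suc)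
  qed
  moreover have "(\<Sum>p\<le>length w. ((\<Prod>l<Suc m. sqrt h ^ length (v p l) * word_moment (v p l)) *
        (sqrt h ^ length (drop p w) * gauss_chain r (drop p w))) / fact p) =
      (\<Prod>l<m. sqrt h ^ length (u l) * word_moment (u l)) * (sqrt h ^ length w * gauss_chain (Suc r) w)"
    unfolding upd [of "\<lambda>l v. sqrt h ^ length v * word_moment v"] gauss_chain.simps sum_distrib_left
  proof (intro sum.cong refl)
    fix p assume "p \<in> {..length w}"
    then have "sqrt h ^ length w = sqrt h ^ length (take p w) * sqrt h ^ length (drop p w)"
      by (simp add: power_add [symmetric])
    then show "(\<Prod>l<m. sqrt h ^ length (u l) * word_moment (u l)) *
        (sqrt h ^ length (take p w) * word_moment (take p w)) *
        (sqrt h ^ length (drop p w) * gauss_chain r (drop p w)) / fact p =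
      (\<Prod>l<m. sqrt h ^ length (u l) * word_moment (u l)) *
        (sqrt h ^ length w * (word_moment (take p w) / fact p * gauss_chain r (drop p w)))"
      by (simp only: mult_ac times_divide_eq_left times_divide_eq_right)
  qed
  ultimately show ?case
    by simp
qed

theorem (in prob_space) expected_sig_coeff_piecewise_linear:
  fixes B :: "real \<Rightarrow> 'a \<Rightarrow> real ^ 'd"
  assumes B: "brownian_motion M B" and "T > 0" and "N \<ge> 1"
  shows "expected_sig_coeff M (\<lambda>t \<omega>. piecewise_linear T N (\<lambda>s. B s \<omega>) t) T w =
    sqrt (T / real N) ^ length w * gauss_chain N w"
proof -
  let ?h = "T / real N"
  have "?h > 0"
    using assms by simp
  from expectation_word_powers_chain_sig [OF B this, where m = 0 and r = N and w = w]
  show ?thesis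
    unfolding expected_sig_coeff_def
    by (simp add: iterated_integral_piecewise_linear [OF assms(2,3) refl] has_bochner_integral_iff
        del: of_nat_Suc)
qed

section \<open>Cutting words into nonempty blocks\<close>

text \<open>
  The block \<open>take p w\<close> is nonempty here, in contrast to \<open>gauss_chain\<close>.
\<close>

primrec block_sum :: "nat \<Rightarrow> 'd::finite list \<Rightarrow> real" where
  "block_sum 0 w = (if w = [] then 1 else 0)"
| "block_sum (Suc q) w =
     (\<Sum>p=1..length w. word_moment (take p w) / fact p * block_sum q (drop p w))"

text \<open>
  Among the \<open>N\<close> factors choose the \<open>q\<close> that receive a nonempty block; the recursion in \<open>N\<close> then becomes
  Pascal's rule.
\<close>

lemma gauss_chain_conv_block_sum:
  "gauss_chain N w = (\<Sum>q\<le>N. real (N choose q) * block_sum q w)"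
proof (induction N arbitrary: w)
  case 0
  then show ?case by simp
next
  case (Suc N)
  have "gauss_chain (Suc N) w = gauss_chain N w +
      (\<Sum>p=1..length w. word_moment (take p w) / fact p * gauss_chain N (drop p w))"
    by (simp add: sum.atMost_shift sum.atLeast1_atMost_eq lessThan_Suc_atMost)
  also have "(\<Sum>p=1..length w. word_moment (take p w) / fact p * gauss_chain N (drop p w)) =
      (\<Sum>q\<le>N. real (N choose q) * block_sum (Suc q) w)"
    unfolding Suc block_sum.simps sum_distrib_left
    by (subst sum.swap) (simp add: mult_ac)
  also have "gauss_chain N w = block_sum 0 w + (\<Sum>q\<le>N. real (N choose Suc q) * block_sum (Suc q) w)"
  proof -
    have "gauss_chain N w = (\<Sum>q\<le>Suc N. real (N choose q) * block_sum q w)"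
      unfolding Suc by simp
    then show ?thesis
      by (simp add: sum.atMost_Suc_shift del: sum.atMost_Suc block_sum.simps)
  qed
  also have "block_sum 0 w + (\<Sum>q\<le>N. real (N choose Suc q) * block_sum (Suc q) w) +
      (\<Sum>q\<le>N. real (N choose q) * block_sum (Suc q) w) =
      (\<Sum>q\<le>Suc N. real (Suc N choose q) * block_sum q w)"
    by (simp add: sum.atMost_Suc_shift sum.distrib [symmetric] algebra_simps
        del: sum.atMost_Suc block_sum.simps)
  finally show ?case .
qed

text \<open>
  With so few letters some block is a single letter, and its moment vanishes.
\<close>

lemma block_sum_short:
  "length w < 2 * q \<Longrightarrow> block_sum q w = 0"
proof (induction q arbitrary: w)
  case 0
  then show ?case by simp
next
  case (Suc q)
  have "word_moment (take p w) * block_sum q (drop p w) = 0" if "p \<in> {1..length w}" for p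
  proof (cases "p = 1")
    case True
    then show ?thesis
      using that by (simp add: word_moment_odd)
  next
    case False
    then show ?thesis
      using that Suc.prems by (intro mult_eq_0_iff [THEN iffD2] disjI2 Suc.IH) auto
  qed
  then show ?case
    by (auto simp: intro!: sum.neutral)
qed

text \<open>
  An odd first block has moment zero, and a long one leaves too few letters for the \<open>q\<close> others.
\<close>

lemma block_sum_Suc_support:
  assumes "A \<subseteq> {1..length w}"
    and support: "\<And>p. p \<in> {1..length w} - A \<Longrightarrow> odd p \<or> length w < p + 2 * q"
  shows "block_sum (Suc q) w =
    (\<Sum>p\<in>A. word_moment (take p w) / fact p * block_sum q (drop p w))"
  unfolding block_sum.simps
proof (rule sum.mono_neutral_right)
  show "\<forall>p\<in>{1..length w} - A. word_moment (take p w) / fact p * block_sum q (drop p w) = 0"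
  proof
    fix p assume p: "p \<in> {1..length w} - A"
    show "word_moment (take p w) / fact p * block_sum q (drop p w) = 0"
      using support [OF p]
    proof
      assume "odd p"
      then show ?thesis
        using p by (simp add: word_moment_odd)
    next
      assume "length w < p + 2 * q"
      then have "block_sum q (drop p w) = 0"
        using p by (intro block_sum_short) auto
      then show ?thesis
        by simp
    qed
  qed
qed (use assms(1) in auto)

lemma block_sum_top_Cons:
  assumes "length w = 2 * q"
  shows "block_sum (Suc q) (a # b # w) = (if a = b then 1 / 2 else 0) * block_sum q w"
proof -
  have "block_sum (Suc q) (a # b # w) = (\<Sum>p\<in>{2}. word_moment (take p (a # b # w)) / fact p *
      block_sum q (drop p (a # b # w)))"
  proof (rule block_sum_Suc_support)
    fix p assume "p \<in> {1..length (a # b # w)} - {2}"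
    then show "odd p \<or> length (a # b # w) < p + 2 * q"
      using assms by (cases "p = 1") auto
  qed auto
  then show ?thesis
    by (simp add: word_moment_pair del: block_sum.simps split: if_splits)
qed

lemma block_sum_subtop_Cons:
  assumes "length w = 2 * Suc q"
  shows "block_sum (Suc q) (a # b # w) = (if a = b then 1 / 2 else 0) * block_sum q w +
    word_moment (take 4 (a # b # w)) / 24 * block_sum q (drop 2 w)"
proof -
  have "block_sum (Suc q) (a # b # w) = (\<Sum>p\<in>{2, 4}. word_moment (take p (a # b # w)) / fact p *
      block_sum q (drop p (a # b # w)))"
  proof (rule block_sum_Suc_support)
    fix p assume "p \<in> {1..length (a # b # w)} - {2, 4}"
    then show "odd p \<or> length (a # b # w) < p + 2 * q"
      using assms by (cases "p = 1 \<or> p = 3") auto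
  qed (use assms in auto)
  then show ?thesis
    by (simp add: word_moment_pair fact_numeral del: block_sum.simps)
qed

section \<open>Words with two adjacent unequal pairs\<close>

definition pairs_word :: "('d \<times> 'd) list \<Rightarrow> 'd list" where
  "pairs_word ps = concat (map (\<lambda>(a, b). [a, b]) ps)"

lemma pairs_word_simps [simp]:
  "pairs_word [] = []"
  "pairs_word ((a, b) # ps) = a # b # pairs_word ps"
  "pairs_word (ps @ qs) = pairs_word ps @ pairs_word qs"
  by (simp_all add: pairs_word_def)

lemma length_pairs_word [simp]: "length (pairs_word ps) = 2 * length ps"
  by (induction ps) auto

lemma pairs_word_diagonal: "pairs_word (map (\<lambda>i. (i, i)) is) = concat (map (\<lambda>i. [i, i]) is)"
  by (induction "is") simp_all

lemma block_sum_pairs: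
  "block_sum (length ps) (pairs_word ps) = (\<Prod>(a, b)\<leftarrow>ps. if a = b then 1 / 2 else 0)"
proof (induction ps)
  case Nil
  then show ?case by simp
next
  case (Cons p ps)
  obtain a b where "p = (a, b)" by (cases p)
  then show ?case
    using Cons block_sum_top_Cons [of "pairs_word ps" "length ps" a b]
    by (simp del: block_sum.simps)
qed

text \<open>
  When the leading pair is a square, a first block of length four would swallow it together with the next
  pair. The rest would then have to be cut into pairs alone, but it still contains one of the two
  unequal pairs, so this option contributes zero, and the square can be stripped off. Once the unequal
  pairs are in front, the block of length four is the only choice.
\<close>

lemma block_sum_one_crossing:
  assumes "i \<noteq> j" and "k \<noteq> l"
  defines "dg \<equiv> map (\<lambda>i::'d::finite. (i, i))"
  shows "block_sum (length is + length js + 1) (pairs_word (dg is @ [(i, j), (k, l)] @ dg js)) =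
    word_moment [i, j, k, l] / 24 * (1 / 2) ^ (length is + length js)"
proof (induction "is")
  case Nil
  have "block_sum (length js) (pairs_word (dg js)) = (1 / 2) ^ length js"
  proof -
    have "(\<Prod>(a, b)\<leftarrow>dg js. if a = b then 1 / 2 else (0::real)) = (1 / 2) ^ length js"
      by (induction js) (simp_all add: dg_def)
    then show ?thesis
      using block_sum_pairs [of "dg js"] by (simp add: dg_def)
  qed
  then show ?case
    using \<open>i \<noteq> j\<close> block_sum_subtop_Cons [of "pairs_word ((k, l) # dg js)" "length js" i j]
    by (simp add: dg_def eval_nat_numeral del: block_sum.simps)
next
  case (Cons a "is")
  let ?w = "pairs_word (dg is @ [(i, j), (k, l)] @ dg js)"
  obtain c d ps where ps: "dg is @ [(i, j), (k, l)] @ dg js = (c, d) # ps"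
    and bad: "\<exists>(x, y)\<in>set ps. x \<noteq> y"
    using assms(1,2) by (cases "is") (auto simp: dg_def)
  have len: "length ps = length is + length js + 1"
    using arg_cong [OF ps, of length] by (simp add: dg_def)
  have "block_sum (length ps) (pairs_word ps) = 0"
    using bad unfolding block_sum_pairs by (force simp: prod_list_zero_iff)
  moreover have "drop 2 ?w = pairs_word ps"
    unfolding ps by simp
  ultimately have "block_sum (Suc (length ps)) (a # a # ?w) = 1 / 2 * block_sum (length ps) ?w"
    using block_sum_subtop_Cons [of ?w "length ps" a a] len by (simp add: dg_def)
  then show ?case
    using Cons len by (simp add: dg_def del: block_sum.simps)
qed

lemma W_words_block_sum:
  fixes w :: "'d::finite list"
  assumes "n \<ge> 2" and "k \<le> n - 2" and "w \<in> W_words n k"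
  shows "length w = 2 * n" and "block_sum n w = 0" and "block_sum (n - 1) w = (1 / 2) ^ (n - 2) / 24"
proof -
  define dg :: "'d list \<Rightarrow> ('d \<times> 'd) list" where "dg = map (\<lambda>i. (i, i))"
  obtain "is" js v' where w: "w = concat (map (\<lambda>i. [i, i]) is) @ v' @ concat (map (\<lambda>i. [i, i]) js)"
    and len: "length is = k" "length js = n - 2 - k" and v': "v' \<in> E_words"
    using assms(3) unfolding W_words_def square_words_def by blast
  obtain i j p q where v'_eq: "v' = [i, j, p, q]" and ne: "i \<noteq> j" "p \<noteq> q"
    and mom: "word_moment [i, j, p, q] = 1"
    using v' word_moment_crossing unfolding E_words_def by fastforce
  have w_pairs: "w = pairs_word (dg is @ [(i, j), (p, q)] @ dg js)"
    by (simp add: w v'_eq dg_def pairs_word_diagonal)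
  have n: "length (dg is @ [(i, j), (p, q)] @ dg js) = n"
    using assms len by (simp add: dg_def)
  show "length w = 2 * n"
    unfolding w_pairs length_pairs_word n ..
  show "block_sum n w = 0"
    using block_sum_pairs [of "dg is @ [(i, j), (p, q)] @ dg js"] ne unfolding w_pairs n by simp
  have "length is + length js = n - 2" "n - 2 + 1 = n - 1"
    using assms len by simp_all
  then show "block_sum (n - 1) w = (1 / 2) ^ (n - 2) / 24"
    using block_sum_one_crossing [OF ne, of "is" js] mom unfolding w_pairs dg_def by simp
qed

section \<open>Asymptotics\<close>

lemma binomial_bigo: "(\<lambda>N. real (N choose q)) \<in> O(\<lambda>N. real N ^ q)"
proof (rule bigoI [where c = 1])
  show "eventually (\<lambda>N. norm (real (N choose q)) \<le> 1 * norm (real N ^ q)) sequentially"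
    using eventually_ge_at_top [of q]
    by eventually_elim (simp add: binomial_le_pow flip: of_nat_power)
qed

text \<open>
  Induction along \<open>(q + 2) * (N choose (q + 2)) = (N - (q + 1)) * (N choose (q + 1))\<close>.
\<close>

lemma binomial_leading:
  "(\<lambda>N. real (N choose Suc q) - real N ^ Suc q / fact (Suc q)) \<in> O(\<lambda>N. real N ^ q)"
proof (induction q)
  case 0
  then show ?case by simp
next
  case (Suc q)
  have step: "real (N choose Suc (Suc q)) - real N ^ Suc (Suc q) / fact (Suc (Suc q)) =
      (real N * (real (N choose Suc q) - real N ^ Suc q / fact (Suc q)) -
        real (Suc q) * real (N choose Suc q)) / real (Suc (Suc q))" for N
  proof -
    define G where "G = real N ^ Suc q / fact (Suc q)"
    have G: "real N ^ Suc (Suc q) / fact (Suc (Suc q)) = real N * G / real (Suc (Suc q))"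
      by (simp add: G_def fact_Suc [of "Suc q"] del: fact_Suc of_nat_Suc)
    have "real (Suc (Suc q)) * real (N choose Suc (Suc q)) = (real N - real (Suc q)) * real (N choose Suc q)"
    proof (cases "Suc q \<le> N")
      case True
      then show ?thesis
        using arg_cong [OF binomial_absorb_comp [of N "Suc q"], of real]
          arg_cong [OF binomial_absorption [of "Suc q" N], of real]
        by (simp only: of_nat_mult of_nat_diff diff_Suc_1)
    qed (simp add: binomial_eq_0)
    then have "real (N choose Suc (Suc q)) =
        (real N - real (Suc q)) * real (N choose Suc q) / real (Suc (Suc q))"
      by (simp add: eq_divide_eq mult.commute del: of_nat_Suc)
    then show ?thesis
      unfolding G G_def [symmetric]
      by (simp only: diff_divide_distrib [symmetric]) (simp add: algebra_simps del: of_nat_Suc)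
  qed
  have "(\<lambda>N. real N * (real (N choose Suc q) - real N ^ Suc q / fact (Suc q))) \<in> O(\<lambda>N. real N * real N ^ q)"
    by (intro landau_o.big.mult Suc landau_o.big_refl)
  moreover have "(\<lambda>N. real (Suc q) * real (N choose Suc q)) \<in> O(\<lambda>N. real N ^ Suc q)"
    using binomial_bigo [of "Suc q"] by simp
  ultimately show ?case
    unfolding step by (auto intro!: landau_o.big.mult_left sum_in_bigo)
qed

text \<open>
  The prefactor \<open>(T / N) ^ n\<close> shifts orders by \<open>n\<close>, so the indices \<open>q \<le> n - 2\<close> and the error of
  \<open>N choose (n - 1)\<close> both disappear in the remainder.
\<close>

theorem gauss_chain_asymptotics:
  fixes w :: "'d::finite list"
  assumes "n \<ge> 2" and "length w = 2 * n" and "block_sum n w = 0" and "T > 0"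
  shows "(\<lambda>N. sqrt (T / real N) ^ (2 * n) * gauss_chain N w -
      T ^ n * block_sum (n - 1) w / fact (n - 1) * (1 / real N)) \<in> O(\<lambda>N. 1 / (real N)\<^sup>2)"
proof -
  obtain m where n: "n = Suc (Suc m)"
    using assms by (metis Suc_le_D numeral_2_eq_2 Suc_le_mono)
  define R where "R N = (\<Sum>q\<le>m. real (N choose q) * block_sum q w) +
    (real (N choose Suc m) - real N ^ Suc m / fact (Suc m)) * block_sum (Suc m) w" for N
  have R: "R \<in> O(\<lambda>N. real N ^ m)"
  proof -
    have "(\<lambda>N. real (N choose q) * block_sum q w) \<in> O(\<lambda>N. real N ^ m)" if "q \<le> m" for q
    proof -
      have "(\<lambda>N. real N ^ q) \<in> O(\<lambda>N. real N ^ m)"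
      proof (rule bigoI [where c = 1])
        show "eventually (\<lambda>N. norm (real N ^ q) \<le> 1 * norm (real N ^ m)) sequentially"
          using eventually_ge_at_top [of 1] by eventually_elim (simp add: power_increasing that)
      qed
      then have "(\<lambda>N. real (N choose q)) \<in> O(\<lambda>N. real N ^ m)"
        by (rule landau_o.big_trans [OF binomial_bigo])
      then show ?thesis
        by (cases "block_sum q w = 0") simp_all
    qed
    then show ?thesis
      unfolding R_def [abs_def]
      by (intro sum_in_bigo big_sum_in_bigo)
        (use binomial_leading in \<open>auto\<close>)
  qed
  have expand: "eventually (\<lambda>N. T ^ n / real N ^ n * R N = sqrt (T / real N) ^ (2 * n) * gauss_chain N w -
      T ^ n * block_sum (n - 1) w / fact (n - 1) * (1 / real N)) sequentially"
    using eventually_ge_at_top [of n]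
  proof eventually_elim
    case (elim N)
    have "gauss_chain N w = (\<Sum>q\<le>n. real (N choose q) * block_sum q w)"
      unfolding gauss_chain_conv_block_sum
      by (rule sum.mono_neutral_right) (use elim assms in \<open>auto simp: block_sum_short\<close>)
    also have "\<dots> = R N + real N ^ Suc m / fact (Suc m) * block_sum (Suc m) w"
      using assms(3) by (simp add: n R_def algebra_simps del: block_sum.simps)
    finally have "gauss_chain N w = R N + real N ^ Suc m / fact (Suc m) * block_sum (Suc m) w" .
    moreover have "sqrt (T / real N) ^ (2 * n) = T ^ n / real N ^ n"
      using \<open>T > 0\<close> by (simp add: power_mult power_divide)
    moreover have "real N > 0"
      using elim n by simp
    ultimately show ?case
      by (simp add: n distrib_left del: block_sum.simps fact_Suc)
  qed
  have "(\<lambda>N. T ^ n / real N ^ n * R N) \<in> O(\<lambda>N. 1 / (real N)\<^sup>2)"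
  proof -
    have "(\<lambda>N. T ^ n / real N ^ n * R N) \<in> O(\<lambda>N. T ^ n / real N ^ n * real N ^ m)"
      by (intro landau_o.big.mult landau_o.big_refl R)
    also have "(\<lambda>N. T ^ n / real N ^ n * real N ^ m) \<in> O(\<lambda>N. 1 / (real N)\<^sup>2)"
    proof (rule bigoI [where c = "T ^ n"])
      show "eventually (\<lambda>N. norm (T ^ n / real N ^ n * real N ^ m) \<le> T ^ n * norm (1 / (real N)\<^sup>2)) sequentially"
        using eventually_gt_at_top [of 0]
        by eventually_elim (use \<open>T > 0\<close> in \<open>simp add: n power2_eq_square field_simps\<close>)
    qed
    finally show ?thesis .
  qed
  then show ?thesis
    using landau_o.big.in_cong [OF expand] by blast
qed

theorem mainTheorem3:
  fixes P :: "'a measure"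
    and B :: "real \<Rightarrow> 'a \<Rightarrow> real ^ 'd"
    and T :: real and n k :: nat and w :: "'d list"
  assumes "prob_space P"
    and "brownian_motion P B"
    and "CARD('d) \<ge> 2" and "n \<ge> 2" and "T > 0" and "k \<le> n - 2"
    and "w \<in> W_words n k"
  shows "(\<lambda>M::nat. expected_sig_coeff P (\<lambda>t \<omega>. piecewise_linear T M (\<lambda>s. B s \<omega>) t) T w
             - 1 / (12 * fact (n - 1)) * (T / 2) ^ (n - 1) * (T / real M))
         \<in> O(\<lambda>M. 1 / (real M)\<^sup>2)"
proof -
  interpret prob_space P by fact
  note w = W_words_block_sum [OF assms(4,6,7)]
  obtain m where n: "n = Suc (Suc m)"
    using assms(4) by (metis Suc_le_D numeral_2_eq_2 Suc_le_mono)
  have const: "T ^ n * block_sum (n - 1) w / fact (n - 1) * (1 / real M) =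
      1 / (12 * fact (n - 1)) * (T / 2) ^ (n - 1) * (T / real M)" for M
    unfolding w(3) by (simp add: n power_divide mult_ac del: fact_Suc)
  have "eventually (\<lambda>M. sqrt (T / real M) ^ (2 * n) * gauss_chain M w -
        T ^ n * block_sum (n - 1) w / fact (n - 1) * (1 / real M) =
      expected_sig_coeff P (\<lambda>t \<omega>. piecewise_linear T M (\<lambda>s. B s \<omega>) t) T w
        - 1 / (12 * fact (n - 1)) * (T / 2) ^ (n - 1) * (T / real M)) sequentially"
    using eventually_ge_at_top [of 1]
    by eventually_elim
      (simp only: expected_sig_coeff_piecewise_linear [OF assms(2,5)] w(1) const)
  from landau_o.big.in_cong [OF this] show ?thesis
    using gauss_chain_asymptotics [OF assms(4) w(1,2) assms(5)] by blast
qed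

end
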